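(* Let $G$ be a non-trivial finite simple connected graph on $n$ vertices. Let $S_0$ be the degree sequence of $G$, re-arranged so that $S_0=X\circ Y^{k}$ (with $X$ possibly empty and $Y$ non-empty), where $k$ is the maximum value attainable over all re-arrangements of the degree sequence. Define strings $S_{i+1}=S_i\circ(cn(S_i))$ for $i\ge 0$, where $cn(S_i)$ is the curling number of the string $S_i$. Then the curling number conjecture holds for $S_0$, i.e. there is some $i\ge 0$ with $cn(S_i)=1$ (a term $1$ is eventually appended).
   Context: For a finite non-empty string $S$ of non-negative integers, the curling number $cn(S)$ is the largest integer $k$ such that $S=X\circ Y^k$, where $\circ$ is concatenation, $X$ is a (possibly empty) prefix and $Y$ is a non-empty string. The Curling Number Conjecture says that if one starts with any finite string and repeatedly extends it by appending the curling number of the current string, then eventually one reaches a $1$. For degree sequences of graphs, the paper's convention is that the entries are first re-arranged into an initial sequence $S_0$ that attains the largest possible curling number; the extended strings $S_1,S_2,\dots$ are not re-arranged. *)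

theory Defs
  imports "HOL-Library.Multiset" "Graph_Theory.Graph_Theory"
begin

abbreviation string_power :: "'a list \<Rightarrow> nat \<Rightarrow> 'a list" where
  "string_power Y k \<equiv> concat (replicate k Y)"

text \<open>Intended for \<open>S \<noteq> []\<close>; then \<open>1 \<le> curling_number S \<le> length S\<close>.\<close>

definition curling_number :: "nat list \<Rightarrow> nat" where
  "curling_number S = Max {k. \<exists>X Y. Y \<noteq> [] \<and> S = X @ string_power Y k}"

lemma curling_exponent_le_length:
  assumes "Y \<noteq> []" "S = X @ string_power Y k"
  shows "k \<le> length S"
proof -
  have "length (string_power Y k) = k * length Y"
    by (induction k) auto
  moreover have "k \<le> k * length Y"
    using assms(1) by (cases Y) auto
  moreover have "length S = length X + length (string_power Y k)"
    using assms(2) by (metis length_append)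
  ultimately show ?thesis
    by linarith
qed

lemma finite_curling_exponents:
  "finite {k. \<exists>X Y. Y \<noteq> [] \<and> S = X @ string_power Y k}"
  by (rule finite_subset[of _ "{..length S}"]) (use curling_exponent_le_length in auto)

lemma curling_number_ge_1:
  assumes "S \<noteq> []"
  shows "1 \<le> curling_number S"
  unfolding curling_number_def
proof (rule Max_ge[OF finite_curling_exponents], safe)
  show "\<exists>X Y. Y \<noteq> [] \<and> S = X @ string_power Y 1"
    using assms by (intro exI[of _ "[]"] exI[of _ S]) auto
qed

primrec curling_extension :: "nat list \<Rightarrow> nat \<Rightarrow> nat list" where
  "curling_extension S 0 = S"
| "curling_extension S (Suc i) =
     curling_extension S i @ [curling_number (curling_extension S i)]"

text \<open>
  An undirected simple graph is a finite symmetric digraph without loops and parallel arcs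
  (locale \<^locale>\<open>graph\<close>), so the degree of a vertex, i.e. its number of neighbours, is its
  out-degree. The predicate holds for every arrangement of the degree sequence.
\<close>

definition is_degree_sequence :: "('a, 'b) pre_digraph \<Rightarrow> nat list \<Rightarrow> bool" where
  "is_degree_sequence G S \<longleftrightarrow> mset S = image_mset (out_degree G) (mset_set (verts G))"

end

theory Submission
  imports Defs "HOL-Library.Sublist"
begin

text \<open>
  Rearranging the sequence so that all copies of one value come last shows that the maximal
  exponent \<open>k\<close> bounds every multiplicity. As each letter of \<open>Y\<close> already occurs \<open>k\<close> times in
  \<open>Y\<^sup>k\<close>, the letters of \<open>Y\<close> are distinct and do not occur in \<open>X\<close>. This is so rigid that the
  extension can be followed by hand.

  Two principles do the work. First, a word ending in a letter \<open>d\<close> that follows a block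
  \<open>c\<^sup>m\<close>, with \<open>c \<noteq> d\<close>, has curling number 1 as soon as \<open>c\<^sup>m d\<close> has not occurred before
  (\<open>curling_number_fresh_run_end\<close>). Secondly, a word that ends in an unprecedentedly long run
  of length \<open>m\<close> has curling number \<open>m\<close> (\<open>curling_number_fresh_run\<close>). Together they settle every
  word ending in such a run \<open>c\<^sup>m\<close> (\<open>fresh_run_reaches_1\<close>): the letter \<open>m\<close> is appended, and
  either it differs from \<open>c\<close>, so that the first principle applies, or it lengthens the run to
  \<open>m + 1 \<noteq> c\<close> and the first principle applies one step later.

  The first letter appended to \<open>X Y\<^sup>k\<close> is \<open>k\<close>, its curling number. If \<open>Y\<close> is a single letter, then \<open>X Y\<^sup>k\<close> ends in
  a run as above. Otherwise the last letter of \<open>Y\<close> has only ever been followed by the first one.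
  If \<open>k\<close> is neither of these two letters, the first principle yields 1 at once. If \<open>k\<close> is the
  last letter of \<open>Y\<close>, then \<open>X Y\<^sup>k k\<close> ends in the new run \<open>k k\<close>. If \<open>k\<close> is the first letter
  of \<open>Y\<close>, then \<open>X Y\<^sup>k k\<close> still has curling number \<open>k\<close>, since it ends in the \<open>k\<close>th power of a
  rotation of \<open>Y\<close>; the next word \<open>X Y\<^sup>k k k\<close> ends in the new run \<open>k k\<close>.
\<close>

section \<open>Bounds for the curling number\<close>

lemma curling_number_ge:
  assumes "Y \<noteq> []" "S = X @ string_power Y k"
  shows "k \<le> curling_number S"
  unfolding curling_number_def
  by (rule Max_ge[OF finite_curling_exponents]) (use assms in blast)

lemma curling_number_le:
  assumes "\<And>X Y j. \<lbrakk>Y \<noteq> []; S = X @ string_power Y j\<rbrakk> \<Longrightarrow> j \<le> b"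
  shows "curling_number S \<le> b"
proof -
  have "0 \<in> {k. \<exists>X Y. Y \<noteq> [] \<and> S = X @ string_power Y k}"
    by (auto intro: exI[of _ "[0]"])
  then show ?thesis
    unfolding curling_number_def
    by (subst Max_le_iff[OF finite_curling_exponents]) (use assms in blast)+
qed

lemma string_power_Suc_right: "string_power Y (Suc j) = string_power Y j @ Y"
  by (induction j) auto

lemma count_list_string_power: "count_list (string_power Y j) a = j * count_list Y a"
  by (induction j) (auto simp: count_list_append)

lemma curling_number_eq_1I:
  assumes "S \<noteq> []" and no_square: "\<And>P Q. Q \<noteq> [] \<Longrightarrow> S \<noteq> P @ Q @ Q"
  shows "curling_number S = 1"
proof -
  have "curling_number S \<le> 1"
  proof (rule curling_number_le)
    fix P Q and j :: nat
    assume Q: "Q \<noteq> []" and S: "S = P @ string_power Q j"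
    show "j \<le> 1"
    proof (rule ccontr)
      assume "\<not> j \<le> 1"
      then obtain i where "j = Suc (Suc i)"
        by (metis One_nat_def not0_implies_Suc not_less_eq_eq zero_le)
      then have "S = (P @ string_power Q i) @ Q @ Q"
        using S by (simp only: string_power_Suc_right append_assoc)
      then show False
        using no_square[OF Q] by blast
    qed
  qed
  then show ?thesis
    using curling_number_ge_1[OF assms(1)] by linarith
qed

text \<open>
  If the last two letters differ, the base of a proper power at the end has length at least two
  and so contains both of them; each occurrence of the base uses up one \<open>a\<close>.
\<close>

lemma curling_number_le_count_penultimate:
  assumes "a \<noteq> b"
  shows "curling_number (Z @ [a, b]) \<le> count_list (Z @ [a, b]) a"
proof (rule curling_number_le)
  fix P Q and j :: nat
  assume Q: "Q \<noteq> []" and S: "Z @ [a, b] = P @ string_power Q j"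
  have pos: "1 \<le> count_list (Z @ [a, b]) a"
    by (simp add: count_list_append)
  show "j \<le> count_list (Z @ [a, b]) a"
  proof (cases "a \<in> set Q")
    case True
    then have "1 \<le> count_list Q a"
      by (metis count_list_0_iff less_one not_le)
    then have "j \<le> count_list (string_power Q j) a"
      by (simp add: count_list_string_power)
    then show ?thesis
      unfolding S by (simp add: count_list_append)
  next
    case False
    show ?thesis
    proof (cases "j \<le> 1")
      case True
      then show ?thesis
        using pos by linarith
    next
      case nontrivial: False
      then obtain i where "j = Suc (Suc i)"
        by (metis One_nat_def not0_implies_Suc not_less_eq_eq zero_le)
      then have S': "(Z @ [a]) @ [b] = (P @ string_power Q i @ Q) @ Q"
        using S by (simp only: string_power_Suc_right append_assoc append_Cons append_Nil)
      obtain R x where Qx: "Q = R @ [x]"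
        using Q by (metis rev_exhaust)
      then have Za: "Z @ [a] = (P @ string_power Q i @ Q) @ R" and "x = b"
        using S' by simp_all
      have "last (Q @ R) = a"
        using Za Q by (metis append_assoc append_is_Nil_conv last_appendR last_snoc)
      then have "a \<in> set (Q @ R)"
        using Q by (metis append_is_Nil_conv last_in_set)
      then show ?thesis
        using False Qx by auto
    qed
  qed
qed

section \<open>Words ending in a new run\<close>

text \<open>
  A square at the end would repeat \<open>c\<^sup>m d\<close> inside its first half if its base is long; if the
  base is short, its first half would end in \<open>c\<close> instead of \<open>d\<close>.
\<close>

lemma curling_number_fresh_run_end:
  assumes "c \<noteq> d" and fresh: "\<not> sublist (replicate m c @ [d]) Z"
  shows "curling_number (Z @ replicate m c @ [d]) = 1"
proof (rule curling_number_eq_1I)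
  fix P Q :: "nat list"
  assume Q: "Q \<noteq> []"
  show "Z @ replicate m c @ [d] \<noteq> P @ Q @ Q"
  proof
    assume S: "Z @ replicate m c @ [d] = P @ Q @ Q"
    then have "Z @ (replicate m c @ [d]) = (P @ Q) @ Q"
      by simp
    then consider R where "Z = (P @ Q) @ R" "R @ replicate m c @ [d] = Q"
      | R where "Z @ R = P @ Q" "replicate m c @ [d] = R @ Q"
      unfolding append_eq_append_conv2[of Z] by blast
    then show False
    proof cases
      case 1
      then have "Z = (P @ R) @ (replicate m c @ [d]) @ R"
        by auto
      then show False
        using fresh by (metis sublist_appendI)
    next
      case 2
      obtain Q' x where Qx: "Q = Q' @ [x]"
        using Q by (metis rev_exhaust)
      with 2(2) have c: "replicate m c = R @ Q'" and "x = d"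
        by simp_all
      show False
      proof (cases "R = []")
        case True
        then have "Z = P @ replicate m c @ [d]"
          using 2 by simp
        then show False
          using fresh by (metis append_Nil2 sublist_appendI)
      next
        case False
        then have "last R = d"
          using 2(1) Qx \<open>x = d\<close> by (metis append_assoc last_appendR last_snoc)
        moreover have "set R \<subseteq> {c}"
          using arg_cong[OF c, of set] by (auto split: if_splits)
        ultimately show False
          using False \<open>c \<noteq> d\<close> last_in_set by fastforce
      qed
    qed
  qed
qed simp

text \<open>
  A base that contains the whole final run would repeat it, so the base of any proper power at
  the end is shorter than the run and consists of \<open>c\<close> only.
\<close>

lemma curling_number_fresh_run:
  assumes "m \<ge> 1" and end_Z: "Z = [] \<or> last Z \<noteq> c"
    and fresh: "\<not> sublist (replicate m c) Z"
  shows "curling_number (Z @ replicate m c) = m"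
proof (rule antisym)
  show "curling_number (Z @ replicate m c) \<le> m"
  proof (rule curling_number_le)
    fix P Q and j :: nat
    assume Q: "Q \<noteq> []" and S: "Z @ replicate m c = P @ string_power Q j"
    show "j \<le> m"
    proof (cases "j \<le> 1")
      case True
      then show ?thesis
        using assms(1) by linarith
    next
      case False
      then obtain i where j: "j = Suc (Suc i)"
        by (metis One_nat_def not0_implies_Suc not_less_eq_eq zero_le)
      then have "Z @ replicate m c = ((P @ string_power Q i) @ Q) @ Q"
        using S by (simp only: string_power_Suc_right append_assoc)
      then consider R where "Z = ((P @ string_power Q i) @ Q) @ R" "R @ replicate m c = Q"
        | R where "replicate m c = R @ Q"
        unfolding append_eq_append_conv2[of Z] by blast
      then show ?thesis
      proof cases
        case 1
        then have "Z = ((P @ string_power Q i) @ R) @ replicate m c @ R"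
          by auto
        then show ?thesis
          using fresh by (metis sublist_appendI)
      next
        \<comment> \<open>The power at the end is a run of \<open>c\<close>, which cannot extend into \<open>Z\<close>.\<close>
        case 2
        have "set Q \<subseteq> set (replicate m c)"
          unfolding 2 by simp
        then have "set Q \<subseteq> {c}"
          by (auto split: if_splits)
        then have power: "string_power Q j = replicate (length (string_power Q j)) c"
          by (intro replicate_eqI) auto
        define t where "t = length (string_power Q j)"
        have "length (string_power Q j) = j * length Q"
          by (induction j) auto
        then have "j \<le> t"
          using Q by (cases Q) (auto simp: t_def)
        moreover have "t \<le> m"
        proof (rule ccontr)
          assume "\<not> t \<le> m"
          then obtain s where "t = Suc s + m"
            using that[of "t - Suc m"] by simp
          then have "Z @ replicate m c = (P @ replicate (Suc s) c) @ replicate m c"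
            using S power by (simp only: t_def[symmetric] replicate_add append_assoc)
          then have "Z = P @ replicate (Suc s) c"
            by blast
          then show False
            using end_Z last_replicate[of "Suc s" c] by (simp del: replicate_Suc)
        qed
        ultimately show ?thesis
          by linarith
      qed
    qed
  qed
  show "m \<le> curling_number (Z @ replicate m c)"
    by (rule curling_number_ge[of "[c]" _ Z]) (auto simp: concat_replicate_single)
qed

lemma curling_extension_add:
  "curling_extension S (i + j) = curling_extension (curling_extension S i) j"
  by (induction j) auto

lemma reaches_1_after_step:
  assumes "\<exists>i. curling_number (curling_extension (S @ [curling_number S]) i) = 1"
  shows "\<exists>i. curling_number (curling_extension S i) = 1"
proof -
  obtain i where "curling_number (curling_extension (curling_extension S 1) i) = 1"
    using assms by auto
  then show ?thesis
    unfolding curling_extension_add[symmetric] by blast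
qed

lemma fresh_run_reaches_1:
  assumes "m \<ge> 1" and end_Z: "Z = [] \<or> last Z \<noteq> c"
    and fresh: "\<not> sublist (replicate m c) Z"
  shows "\<exists>i. curling_number (curling_extension (Z @ replicate m c) i) = 1"
proof -
  have fresh_extended: "\<not> sublist (replicate m c @ xs) Z" for xs
    using fresh by (metis append_Nil sublist_appendI sublist_order.order.trans)
  have run_end: "\<exists>i. curling_number (curling_extension (Z @ replicate l c) i) = 1"
    if l: "l \<ge> 1" "l \<noteq> c" and fresh_l: "\<And>xs. \<not> sublist (replicate l c @ xs) Z" for l
  proof (rule reaches_1_after_step)
    have "curling_number (Z @ replicate l c) = l"
      using curling_number_fresh_run[OF l(1) end_Z] fresh_l[of "[]"] by simp
    moreover have "curling_number (Z @ replicate l c @ [l]) = 1"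
      using curling_number_fresh_run_end l(2) fresh_l by metis
    ultimately show
      "\<exists>i. curling_number (curling_extension
             ((Z @ replicate l c) @ [curling_number (Z @ replicate l c)]) i) = 1"
      by (intro exI[of _ 0]) simp
  qed
  show ?thesis
  proof (cases "m = c")
    case False
    then show ?thesis
      using run_end assms(1) fresh_extended by blast
  next
    \<comment> \<open>The appended letter prolongs the run by one.\<close>
    case True
    have longer: "replicate (Suc m) c = replicate m c @ [c]"
      by (simp add: replicate_append_same)
    show ?thesis
    proof (rule reaches_1_after_step)
      have "curling_number (Z @ replicate m c) = c"
        using curling_number_fresh_run[OF assms] True by simp
      then show
        "\<exists>i. curling_number (curling_extension
               ((Z @ replicate m c) @ [curling_number (Z @ replicate m c)]) i) = 1"
        using run_end[of "Suc m"] True fresh_extended longer by (simp del: replicate_Suc)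
    qed
  qed
qed

section \<open>Powers of a word with distinct letters\<close>

text \<open>
  Two adjacent letters lie in one copy of \<open>Y\<close> or meet at the boundary of two copies; the
  boundary between \<open>X\<close> and the first copy is excluded because \<open>a\<close> does not occur in \<open>X\<close>.
\<close>

lemma sublist_pair_string_power:
  assumes "a \<in> set Y" "set X \<inter> set Y = {}" "sublist [a, b] (X @ string_power Y j)"
  shows "sublist [a, b] Y \<or> a = last Y \<and> b = hd Y"
  using assms(3)
proof (induction j)
  case 0
  then have "a \<in> set X"
    using set_mono_sublist by fastforce
  then show ?case
    using assms(1,2) by blast
next
  case (Suc j)
  have "X @ string_power Y (Suc j) = (X @ string_power Y j) @ Y"
    by (simp only: string_power_Suc_right append_assoc)
  with Suc.prems have "sublist [a, b] ((X @ string_power Y j) @ Y)"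
    by metis
  then consider "sublist [a, b] (X @ string_power Y j)" | "sublist [a, b] Y"
    | xs ys where "[a, b] = xs @ ys" "suffix xs (X @ string_power Y j)" "prefix ys Y"
      "xs \<noteq> []" "ys \<noteq> []"
    unfolding sublist_append[of _ _ Y]
    by (metis append_Nil append_Nil2 prefix_imp_sublist suffix_imp_sublist)
  then show ?case
  proof cases
    case 3
    then have "xs = [a]" "ys = [b]"
      by (auto simp: Cons_eq_append_conv)
    with 3 obtain P R where "X @ string_power Y j = P @ [a]" "Y = b # R"
      by (auto simp only: suffix_def prefix_def append_Cons append_Nil)
    then have ends: "a = last (X @ string_power Y j)" "X @ string_power Y j \<noteq> []" "b = hd Y"
      by (metis last_snoc, metis snoc_eq_iff_butlast, simp)
    moreover have "last (X @ string_power Y j) = last Y" if "j > 0"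
    proof -
      from that obtain i where "j = Suc i"
        using gr0_implies_Suc by blast
      moreover have "Y \<noteq> []"
        using assms(1) by auto
      ultimately show ?thesis
        by (simp add: string_power_Suc_right del: replicate_Suc)
    qed
    moreover have "j > 0"
    proof (rule ccontr)
      assume "\<not> j > 0"
      then have "a \<in> set X"
        using ends by simp
      then show False
        using assms(1,2) by blast
    qed
    ultimately show ?thesis
      using ends by simp
  qed (use Suc.IH in auto)
qed

lemma distinct_sublist_pair:
  assumes "distinct Y" "sublist [a, b] Y"
  shows "a \<noteq> b" "a \<noteq> last Y"
proof -
  obtain P Q where "Y = P @ [a, b] @ Q"
    using assms(2) unfolding sublist_def by blast
  then show "a \<noteq> b" "a \<noteq> last Y"
    using assms(1) last_in_set[of "b # Q"] by auto
qed

section \<open>Arrangements with the largest possible power\<close>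

text \<open>
  A letter of \<open>Y\<close> occurs at least \<open>k\<close> times in \<open>Y\<^sup>k\<close>, so the bound leaves no room for a second
  occurrence in \<open>Y\<close> or for one in \<open>X\<close>.
\<close>

lemma distinct_base_of_maximal_power:
  assumes "k \<ge> 1" and bound: "\<And>a. count_list (X @ string_power Y k) a \<le> k"
  shows "distinct Y" "set X \<inter> set Y = {}"
proof -
  have count: "count_list X a + k * count_list Y a \<le> k" for a
    using bound[of a] by (simp add: count_list_append count_list_string_power)
  have one: "count_list Y a = 1 \<and> count_list X a = 0" if "a \<in> set Y" for a
  proof -
    have pos: "count_list Y a \<noteq> 0"
      using that by (simp add: count_list_0_iff)
    have "k * count_list Y a \<le> k * 1"
      using count[of a] by linarith
    then have "count_list Y a \<le> 1"
      using assms(1) by simp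
    with pos have "count_list Y a = 1"
      by linarith
    with count[of a] show ?thesis
      by simp
  qed
  show "set X \<inter> set Y = {}"
    using one by (auto simp: count_list_0_iff)
  have "count (mset Y) a = (if a \<in> set Y then 1 else 0)" for a
    using one by (auto simp: count_mset count_list_0_iff)
  then show "distinct Y"
    by (simp add: distinct_count_atmost_1)
qed

text \<open>Every copy of a base at the end uses up one copy of the first letter of that base.\<close>

lemma curling_number_maximal_power:
  assumes "k \<ge> 1" "Y \<noteq> []" and bound: "\<And>a. count_list (X @ string_power Y k) a \<le> k"
  shows "curling_number (X @ string_power Y k) = k"
proof (rule antisym)
  show "curling_number (X @ string_power Y k) \<le> k"
  proof (rule curling_number_le)
    fix P Q and j :: nat
    assume Q: "Q \<noteq> []" and S: "X @ string_power Y k = P @ string_power Q j"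
    have "1 \<le> count_list Q (hd Q)"
      using Q by (cases Q) auto
    then have "j \<le> count_list (P @ string_power Q j) (hd Q)"
      by (simp add: count_list_append count_list_string_power trans_le_add2)
    also have "\<dots> \<le> k"
      using bound unfolding S by blast
    finally show "j \<le> k" .
  qed
qed (use curling_number_ge assms(2) in blast)

theorem maximal_power_reaches_1:
  assumes k: "k \<ge> 1" and Y: "Y \<noteq> []"
    and bound: "\<And>a. count_list (X @ string_power Y k) a \<le> k"
  shows "\<exists>i. curling_number (curling_extension (X @ string_power Y k) i) = 1"
proof -
  define S where "S = X @ string_power Y k"
  note distinct = distinct_base_of_maximal_power[OF k bound]
  have cn_S: "curling_number S = k"
    unfolding S_def by (rule curling_number_maximal_power[OF k Y bound])
  obtain y Y' where Y': "Y = Y' @ [y]"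
    using Y by (metis rev_exhaust)
  obtain Z where Z: "S = Z @ [y]"
  proof
    show "S = (X @ string_power Y (k - 1) @ Y') @ [y]"
      using k Y' string_power_Suc_right[where Y = Y and j = "k - 1"] by (simp add: S_def)
  qed
  have pair: "sublist [a, b] Y \<or> a = y \<and> b = hd Y" if "a \<in> set Y" "sublist [a, b] S" for a b
    using sublist_pair_string_power[OF that(1) distinct(2) that(2)[unfolded S_def]] Y' by simp
  have after_y: "b = hd Y" if "sublist [y, b] S" for b
    using pair[of y b] that distinct_sublist_pair(2)[OF distinct(1), of y b] Y' by auto
  have "\<exists>i. curling_number (curling_extension S i) = 1"
  proof (cases "Y' = []")
    case True
    then have "y \<notin> set X" "S = X @ replicate k y"
      using distinct(2) Y' by (auto simp: S_def concat_replicate_single)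
    moreover have "\<not> sublist (replicate k y) X"
      using \<open>y \<notin> set X\<close> k set_mono_sublist[of "replicate k y" X] by auto
    moreover have "X = [] \<or> last X \<noteq> y"
      using \<open>y \<notin> set X\<close> by auto
    ultimately show ?thesis
      using fresh_run_reaches_1[OF k] by metis
  next
    case False
    then have hd_Y: "hd Y \<in> set Y" "hd Y \<noteq> y"
      using Y' distinct(1) by (cases Y'; auto)+
    have no_double: "\<not> sublist [a, a] S" if "a \<in> set Y" for a
      using pair[OF that, of a] distinct_sublist_pair(1)[OF distinct(1)] hd_Y(2) by blast
    \<comment> \<open>A letter of \<open>Y\<close> that gets doubled at the end starts a new run of length two.\<close>
    have doubled: "\<exists>i. curling_number (curling_extension (V @ [a, a]) i) = 1"
      if "\<not> sublist [a, a] (V @ [a])" for V a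
    proof -
      have "\<not> sublist [a, a] V"
        using that by (metis append_Nil sublist_appendI sublist_order.order.trans)
      moreover have "V = [] \<or> last V \<noteq> a"
      proof (rule ccontr)
        assume "\<not> ?thesis"
        then have "V @ [a] = butlast V @ [a, a] @ []"
          by (metis append.assoc append_Cons append_Nil append_Nil2 append_butlast_last_id)
        then show False
          using that by (metis sublist_appendI)
      qed
      ultimately show ?thesis
        using fresh_run_reaches_1[of 2 V a] by (simp add: numeral_2_eq_2)
    qed
    consider "k = y" | "k = hd Y" | "k \<noteq> y" "k \<noteq> hd Y"
      by blast
    then show ?thesis
    proof cases
      case 1
      have "y \<in> set Y"
        using Y' by simp
      then have "\<exists>i. curling_number (curling_extension (Z @ [y, y]) i) = 1"
        using doubled[of y Z] no_double[of y] Z by simp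
      then show ?thesis
        using reaches_1_after_step[of S] cn_S 1 Z by simp
    next
      case 2
      have S_k: "S @ [k] = Z @ [y, k]"
        using Z by simp
      have "curling_number (S @ [k]) \<le> count_list (S @ [k]) y"
        unfolding S_k using 2 hd_Y(2) by (intro curling_number_le_count_penultimate) simp
      also have "\<dots> \<le> k"
        using bound[of y] 2 hd_Y(2) by (simp add: S_def count_list_append)
      finally have upper: "curling_number (S @ [k]) \<le> k" .
      \<comment> \<open>\<open>Y\<^sup>k k = k (T k)\<^sup>k\<close>, where \<open>T\<close> is \<open>Y\<close> without its first letter \<open>k\<close>.\<close>
      have rotate: "string_power (k # T) j @ [k] = k # string_power (T @ [k]) j" for T j
        by (induction j) auto
      have "Y = k # tl Y"
        using Y 2 by simp
      then have "S @ [k] = (X @ [k]) @ string_power (tl Y @ [k]) k"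
        using rotate[where T = "tl Y" and j = k] by (simp add: S_def)
      then have "k \<le> curling_number (S @ [k])"
        using curling_number_ge[of "tl Y @ [k]" _ "X @ [k]"] by blast
      with upper have cn_S_k: "curling_number (S @ [k]) = k"
        by simp
      have "\<not> sublist [k, k] (S @ [k])"
      proof
        assume "sublist [k, k] (S @ [k])"
        then obtain P R where PR: "Z @ [y, k] = P @ [k, k] @ R"
          unfolding S_k sublist_def by blast
        show False
        proof (cases R rule: rev_cases)
          case Nil
          then show False
            using PR 2 hd_Y(2) by simp
        next
          case (snoc R' x)
          then have "S = P @ [k, k] @ R'"
            using PR Z by simp
          then show False
            using no_double[of k] 2 hd_Y(1) by (metis sublist_appendI)
        qed
      qed
      then have "\<exists>i. curling_number (curling_extension (S @ [k, k]) i) = 1"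
        by (rule doubled)
      then have "\<exists>i. curling_number (curling_extension (S @ [k]) i) = 1"
        using reaches_1_after_step[of "S @ [k]"] cn_S_k by simp
      then show ?thesis
        using reaches_1_after_step[of S] cn_S by simp
    next
      case 3
      have "\<not> sublist [y, k] Z"
        using after_y[of k] 3(2) Z by (metis append_Nil sublist_appendI sublist_order.order.trans)
      then have "curling_number (Z @ replicate 1 y @ [k]) = 1"
        using 3(1) by (intro curling_number_fresh_run_end) auto
      then have "curling_number (curling_extension S 1) = 1"
        using cn_S Z by simp
      then show ?thesis
        by blast
    qed
  qed
  then show ?thesis
    unfolding S_def .
qed

theorem theorem2p7:
  fixes G :: "('a, 'b) pre_digraph"
    and n k :: nat
    and S\<^sub>0 X Y :: "nat list"
  assumes "graph G"
    and "Digraph_Component.connected G"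
    and "card (verts G) = n"
    and "n \<ge> 2"
    and "is_degree_sequence G S\<^sub>0"
    and "Y \<noteq> []"
    and "S\<^sub>0 = X @ string_power Y k"
    and "\<forall>T X' Y' k'. is_degree_sequence G T \<and> Y' \<noteq> [] \<and> T = X' @ string_power Y' k'
           \<longrightarrow> k' \<le> k"
  shows "\<exists>i. curling_number (curling_extension S\<^sub>0 i) = 1"
proof -
  have "length S\<^sub>0 = card (verts G)"
    using assms(5) unfolding is_degree_sequence_def
    by (metis size_image_mset size_mset size_mset_set)
  then have "S\<^sub>0 \<noteq> []"
    using assms(3,4) by auto
  have bound: "count_list S\<^sub>0 a \<le> k" for a
  proof -
    \<comment> \<open>Collecting all copies of \<open>a\<close> at the end realises their number as an exponent.\<close>
    define T where "T = filter (\<lambda>x. x \<noteq> a) S\<^sub>0 @ string_power [a] (count_list S\<^sub>0 a)"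
    have "mset T = mset S\<^sub>0"
      by (rule multiset_eqI) (auto simp: T_def concat_replicate_single count_mset)
    then have "is_degree_sequence G T"
      using assms(5) by (simp add: is_degree_sequence_def)
    then show ?thesis
      using assms(8) T_def by blast
  qed
  have "1 \<le> count_list S\<^sub>0 (hd S\<^sub>0)"
    using \<open>S\<^sub>0 \<noteq> []\<close> by (cases S\<^sub>0) auto
  then have "k \<ge> 1"
    using bound le_trans by blast
  then show ?thesis
    using maximal_power_reaches_1 assms(6,7) bound by blast
qed

end
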